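(* Let $n_0,n_1,n_2\in\mathbb{Z}_{>0}$ and $X=[n_0;n_1,n_2]=n_0+\cfrac{1}{n_1+\cfrac{1}{n_2}}$. Then $$\mathrm{F}([n_0;n_1,n_2]) = (F_{n_1-1}L_{n_0}+F_{n_1-2}F_{n_0+1})\,F_{n_2}+(F_{n_1-2}L_{n_0}+F_{n_1-3}F_{n_0+1})\,F_{n_2+1}.$$
   Context: The conumerator function is the unique map $\mathrm{con}:\mathbb{Q}_{>0}\to\mathbb{Z}_{>0}$ with $\mathrm{con}(1)=1$ and, for all $X\in\mathbb{Q}_{>0}$, $\mathrm{con}(1+X)=\mathrm{con}(X)+\mathrm{con}(1/X)$ and $\mathrm{con}\left(\tfrac{1}{1+X}\right)=\mathrm{con}(X)$. The codenominator function is $\mathrm{F}(X):=\mathrm{con}(1/X)$ for $X\in\mathbb{Q}_{>0}$; equivalently $\mathrm{F}(1)=1$, $\mathrm{F}(1+X)=\mathrm{F}(1/X)$, $\mathrm{F}\left(\tfrac{1}{1+X}\right)=\mathrm{F}(X)+\mathrm{F}(1/X)$. The Fibonacci numbers are $F_0=0$, $F_1=1$, $F_n=F_{n-1}+F_{n-2}$, and the Lucas numbers are $L_0=2$, $L_1=1$, $L_n=L_{n-1}+L_{n-2}$; for negative indices $F_{-n}=(-1)^{n-1}F_n$ and $L_{-n}=(-1)^nL_n$. *)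

theory Defs
  imports "HOL-Number_Theory.Fib"
begin

text \<open>
  The positive rationals are rendered inside \<^typ>\<open>rat\<close>: a map on them is a function on
  \<^typ>\<open>rat\<close> whose values at nonpositive arguments are irrelevant.
\<close>

definition is_conumerator :: "(rat \<Rightarrow> int) \<Rightarrow> bool" where
  "is_conumerator f \<longleftrightarrow>
     (\<forall>X>0. f X > 0) \<and>
     f 1 = 1 \<and>
     (\<forall>X>0. f (1 + X) = f X + f (1 / X)) \<and>
     (\<forall>X>0. f (1 / (1 + X)) = f X)"

text \<open>
  Fixing the value 0 off the positive rationals makes the function on all of \<^typ>\<open>rat\<close>
  unique; existence and uniqueness are proved below as \<open>ex1_conumerator\<close>.
\<close>

definition conumerator :: "rat \<Rightarrow> int" where
  "conumerator = (THE f. is_conumerator f \<and> (\<forall>X\<le>0. f X = 0))"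

definition codenominator :: "rat \<Rightarrow> int" where
  "codenominator X = conumerator (1 / X)"

definition fib_int :: "int \<Rightarrow> int" where
  "fib_int n =
     (if n \<ge> 0 then int (fib (nat n))
      else (- 1) ^ (nat (- n) - 1) * int (fib (nat (- n))))"

fun lucas :: "nat \<Rightarrow> nat" where
  "lucas 0 = 2"
| "lucas (Suc 0) = 1"
| "lucas (Suc (Suc n)) = lucas (Suc n) + lucas n"

definition lucas_int :: "int \<Rightarrow> int" where
  "lucas_int n =
     (if n \<ge> 0 then int (lucas (nat n))
      else (- 1) ^ nat (- n) * int (lucas (nat (- n))))"

lemma is_conumerator_unique:
  assumes f: "is_conumerator f" and g: "is_conumerator g" and "X > 0"
  shows "f X = g X"
proof -
  have main: "f (of_nat a / of_nat b) = g (of_nat a / of_nat b)" if "a > 0" "b > 0" for a b :: nat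
    using that
  proof (induction "a + b" arbitrary: a b rule: less_induct)
    case less
    consider "a = b" | "a > b" | "a < b" by linarith
    then show ?case
    proof cases
      case 1
      then show ?thesis using less.prems f g by (simp add: is_conumerator_def)
    next
      case 2
      define c where "c = a - b"
      have c: "c > 0" "a = b + c" using 2 by (auto simp: c_def)
      define Y :: rat where "Y = of_nat c / of_nat b"
      have Y: "Y > 0" "of_nat a / of_nat b = 1 + Y" "1 / Y = of_nat b / of_nat c"
        using c less.prems by (auto simp: Y_def field_simps)
      have "f Y = g Y" "f (1 / Y) = g (1 / Y)"
        using less.hyps[of c b] less.hyps[of b c] c less.prems unfolding Y(3)
        by (auto simp: Y_def)
      then show ?thesis using f g Y(1) unfolding Y(2) by (simp add: is_conumerator_def)
    next
      case 3
      define c where "c = b - a"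
      have c: "c > 0" "b = a + c" using 3 by (auto simp: c_def)
      define Y :: rat where "Y = of_nat c / of_nat a"
      have Y: "Y > 0" "of_nat a / of_nat b = 1 / (1 + Y)"
        using c less.prems by (auto simp: Y_def field_simps)
      have "f Y = g Y" using less.hyps[of c a] c less.prems by (auto simp: Y_def)
      then show ?thesis using f g Y(1) unfolding Y(2) by (simp add: is_conumerator_def)
    qed
  qed
  obtain p q where pq: "X = of_int p / of_int q" "q > 0"
    by (metis quotient_of_div quotient_of_denom_pos surj_pair)
  then have "p > 0" using \<open>X > 0\<close> by (simp add: zero_less_divide_iff)
  then show ?thesis using main[of "nat p" "nat q"] pq by simp
qed

function con_pair :: "nat \<Rightarrow> nat \<Rightarrow> int" where
  "con_pair a b =
     (if a = 0 \<or> b = 0 \<or> a = b then 1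
      else if a > b then con_pair (a - b) b + con_pair b (a - b)
      else con_pair (b - a) a)"
  by pat_completeness auto
termination by (relation "measure (\<lambda>(a, b). a + b)") auto

declare con_pair.simps [simp del]

lemma con_pair_pos: "con_pair a b > 0"
proof (induction a b rule: con_pair.induct)
  case (1 a b)
  then show ?case by (subst con_pair.simps) auto
qed

lemma ex_conumerator: "\<exists>f. is_conumerator f"
proof -
  define f where
    "f X = con_pair (nat (fst (quotient_of X))) (nat (snd (quotient_of X)))" for X
  have f_eq: "f (of_nat a / of_nat b) = con_pair a b" if "coprime a b" "b > 0" for a b
  proof -
    have "quotient_of (Fract (int a) (int b)) = (int a, int b)"
      using that by (simp add: quotient_of_Fract normalize_stable)
    moreover have "Fract (int a) (int b) = of_nat a / of_nat b"
      by (simp add: Fract_of_int_quotient)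
    ultimately show ?thesis by (simp add: f_def)
  qed
  have steps: "f (1 + X) = f X + f (1 / X)" "f (1 / (1 + X)) = f X" if "X > 0" for X
  proof -
    obtain p q where pq: "X = of_int p / of_int q" "q > 0" "coprime p q"
      by (metis quotient_of_div quotient_of_denom_pos quotient_of_coprime surj_pair)
    then have "p > 0" using \<open>X > 0\<close> by (simp add: zero_less_divide_iff)
    define a b where "a = nat p" and "b = nat q"
    have int_ab: "p = int a" "q = int b" using \<open>p > 0\<close> \<open>q > 0\<close> by (auto simp: a_def b_def)
    have ab: "a > 0" "b > 0" "coprime a b"
      using \<open>p > 0\<close> pq int_ab by auto
    have X: "X = of_nat a / of_nat b" using pq(1) int_ab by simp
    have X': "1 / X = of_nat b / of_nat a" "1 + X = of_nat (a + b) / of_nat b"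
      "1 / (1 + X) = of_nat b / of_nat (a + b)"
      using ab by (auto simp: X field_simps)
    have cop: "coprime b a" "coprime (a + b) b" "coprime b (a + b)"
      using ab gcd_add1[of a b] gcd.commute[of b]
      by (simp_all add: coprime_iff_gcd_eq_1 del: gcd_add1)
    have con: "con_pair (a + b) b = con_pair a b + con_pair b a"
      "con_pair b (a + b) = con_pair a b"
      using ab by (subst con_pair.simps; simp)+
    have eqs: "f X = con_pair a b" "f (1 / X) = con_pair b a"
      "f (1 + X) = con_pair (a + b) b" "f (1 / (1 + X)) = con_pair b (a + b)"
      using f_eq[of a b] f_eq[of b a] f_eq[of "a + b" b] f_eq[of b "a + b"] ab cop
      unfolding X'
      by (simp_all add: X del: of_nat_add)
    show "f (1 + X) = f X + f (1 / X)" "f (1 / (1 + X)) = f X"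
      by (simp_all only: eqs con)
  qed
  have "f 1 = 1" using f_eq[of 1 1] by (simp add: con_pair.simps)
  then have "is_conumerator f"
    unfolding is_conumerator_def using steps con_pair_pos f_def by auto
  then show ?thesis by blast
qed

lemma ex1_conumerator: "\<exists>!f. is_conumerator f \<and> (\<forall>X\<le>0. f X = 0)"
proof (rule ex_ex1I)
  obtain f where f: "is_conumerator f" using ex_conumerator ..
  have pos: "1 + X > 0" if "X > 0" for X :: rat using that by simp
  have "is_conumerator (\<lambda>X. if X > 0 then f X else 0)"
    using f pos unfolding is_conumerator_def by simp
  then show "\<exists>f. is_conumerator f \<and> (\<forall>X\<le>0. f X = 0)"
    by (intro exI[of _ "\<lambda>X. if X > 0 then f X else 0"]) auto
next
  fix f g
  assume f: "is_conumerator f \<and> (\<forall>X\<le>0. f X = 0)" and g: "is_conumerator g \<and> (\<forall>X\<le>0. g X = 0)"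
  show "f = g"
  proof
    fix X :: rat
    show "f X = g X"
      using f g is_conumerator_unique[of f g X] by (cases "X > 0") auto
  qed
qed

lemma is_conumerator_conumerator: "is_conumerator conumerator"
  using theI'[OF ex1_conumerator] unfolding conumerator_def by blast

end

theory Submission
  imports Defs
begin

text \<open>
  Adding 1 to \<open>X\<close> sends the pair of codenominator and conumerator \<open>(F, c)\<close> to \<open>(c, F + c)\<close>, so
  adding \<open>n\<close> acts by the \<open>n\<close>-th power of the Fibonacci matrix, and inverting \<open>X\<close> swaps the two
  entries. Three such steps evaluate the continued fraction, and the formula follows from
  \<open>L\<^sub>n = F\<^sub>n\<^sub>+\<^sub>1 + F\<^sub>n\<^sub>-\<^sub>1\<close>.
\<close>

lemma fib_int_of_nat [simp]: "fib_int (int n) = int (fib n)"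
  by (simp add: fib_int_def)

text \<open>Needed on all integers: for \<open>n\<^sub>1 = 1\<close> the indices
  \<open>n\<^sub>1 - 2\<close> and \<open>n\<^sub>1 - 3\<close> are negative.\<close>

lemma fib_int_rec: "fib_int (n + 2) = fib_int (n + 1) + fib_int n"
proof -
  \<comment> \<open>The split follows the branches of \<open>fib_int\<close>: at
    \<open>n = - 1\<close> the three indices straddle 0.\<close>
  consider k where "n = int k" | "n = - 1" | k where "n = - int (k + 2)"
  proof -
    have "\<exists>k. n = - int (k + 2)" if "n < 0" "n \<noteq> - 1"
      using that by (intro exI[of _ "nat (- n - 2)"]) simp
    then show ?thesis using that by (metis nonneg_int_cases not_less)
  qed
  then show ?thesis
  proof cases
    case 1
    then have "n + 2 = int (Suc (Suc k))" "n + 1 = int (Suc k)" by simp_all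
    then show ?thesis unfolding 1 by (simp only: fib_int_of_nat) simp
  next
    case 2
    then show ?thesis by (simp add: fib_int_def)
  next
    case 3
    have "nat (- n) = k + 2" "nat (- (n + 1)) = k + 1" "nat (- (n + 2)) = k"
      using 3 by simp_all
    \<comment> \<open>For \<open>k = 0\<close> the index \<open>n + 2\<close> is 0 and falls into
      the nonnegative branch of \<open>fib_int\<close>; the split on \<open>k\<close> below isolates
      this.\<close>
    moreover have "n < 0" "n + 1 < 0" "n + 2 < 0 \<or> n + 2 = 0 \<and> k = 0" using 3 by auto
    ultimately show ?thesis
      by (cases k) (auto simp: fib_int_def distrib_left)
  qed
qed

text \<open>Stated at \<open>Suc n\<close> so that the lower index needs no truncated
  subtraction.\<close>

lemma lucas_fib: "lucas (Suc n) = fib (n + 2) + fib n"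
  by (induction n rule: fib.induct) simp_all

lemma lucas_int_eq_fib_int:
  assumes "n > 0"
  shows "lucas_int n = fib_int (n + 1) + fib_int (n - 1)"
proof -
  obtain k where n: "n = int (Suc k)"
    using assms by (metis zero_less_imp_eq_int gr0_conv_Suc)
  then have "n + 1 = int (k + 2)" "n - 1 = int k" by simp_all
  moreover have "lucas_int n = int (lucas (Suc k))"
    unfolding n by (simp add: lucas_int_def del: of_nat_Suc)
  ultimately show ?thesis
    by (simp only: fib_int_of_nat lucas_fib of_nat_add[of "fib (k + 2)"])
qed

lemma codenominator_inverse: "codenominator (1 / X) = conumerator X"
  by (simp add: codenominator_def)

lemma conumerator_inverse: "conumerator (1 / X) = codenominator X"
  by (simp add: codenominator_def)

lemma conumerator_1: "conumerator 1 = 1"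
  using is_conumerator_conumerator by (simp add: is_conumerator_def)

lemma conumerator_1_plus:
  "X > 0 \<Longrightarrow> conumerator (1 + X) = conumerator X + codenominator X"
  using is_conumerator_conumerator by (simp add: is_conumerator_def codenominator_def)

lemma codenominator_1_plus: "X > 0 \<Longrightarrow> codenominator (1 + X) = conumerator X"
  using is_conumerator_conumerator by (simp add: is_conumerator_def codenominator_def)

text \<open>The coefficients are the entries of the \<open>n\<close>-th power of the Fibonacci
  matrix. The two parts are proved together because the step for each draws on the other
  component.\<close>

lemma codenominator_conumerator_of_nat_plus:
  assumes "X > 0"
  shows "codenominator (of_nat n + X) =
      fib_int (int n - 1) * codenominator X + fib_int (int n) * conumerator X \<and>
    conumerator (of_nat n + X) =
      fib_int (int n) * codenominator X + fib_int (int n + 1) * conumerator X"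
proof (induction n)
  case 0
  \<comment> \<open>The value \<open>fib_int (- 1) = 1\<close> makes the zeroth power the identity
    matrix.\<close>
  show ?case by (simp add: fib_int_def)
next
  case (Suc n)
  have pos: "of_nat n + X > 0" using assms by (simp add: add_nonneg_pos)
  have rec: "fib_int (int n + 2) = fib_int (int n + 1) + fib_int (int n)"
    "fib_int (int n + 1) = fib_int (int n) + fib_int (int n - 1)"
    using fib_int_rec[of "int n"] fib_int_rec[of "int n - 1"] by (simp_all add: add.commute)
  have eqs: "of_nat (Suc n) + X = 1 + (of_nat n + X)" "int (Suc n) - 1 = int n"
    "int (Suc n) = int n + 1" "int n + 1 + 1 = int n + 2"
    by simp_all
  show ?case
    unfolding eqs codenominator_1_plus[OF pos] conumerator_1_plus[OF pos]
      conjunct1[OF Suc.IH] conjunct2[OF Suc.IH]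
    unfolding rec by (simp add: distrib_left distrib_right)
qed

lemma
  assumes "n \<ge> 0" and "X > 0"
  shows codenominator_of_int_plus: "codenominator (of_int n + X) =
      fib_int (n - 1) * codenominator X + fib_int n * conumerator X"
    and conumerator_of_int_plus: "conumerator (of_int n + X) =
      fib_int n * codenominator X + fib_int (n + 1) * conumerator X"
  using codenominator_conumerator_of_nat_plus[OF assms(2), of "nat n"] assms(1) by simp_all

lemma
  assumes "n > 0"
  shows codenominator_of_int: "codenominator (of_int n) = fib_int n"
    and conumerator_of_int: "conumerator (of_int n) = fib_int (n + 1)"
proof -
  \<comment> \<open>The shift requires a positive argument, so \<open>n\<close> is reached from 1 in
    \<open>n - 1\<close> steps rather than from 0.\<close>
  have n: "n - 1 \<ge> 0" "(of_int n :: rat) = of_int (n - 1) + 1" using assms by simp_all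
  have "codenominator 1 = 1" by (simp add: codenominator_def conumerator_1)
  then show "codenominator (of_int n) = fib_int n" "conumerator (of_int n) = fib_int (n + 1)"
    using codenominator_of_int_plus[OF n(1), of 1] conumerator_of_int_plus[OF n(1), of 1]
      fib_int_rec[of "n - 2"] fib_int_rec[of "n - 1"]
    by (simp_all add: n(2) conumerator_1 add.commute del: of_int_diff)
qed

theorem lemma3p2:
  fixes n\<^sub>0 n\<^sub>1 n\<^sub>2 :: int
  assumes "n\<^sub>0 > 0" and "n\<^sub>1 > 0" and "n\<^sub>2 > 0"
  shows "codenominator (of_int n\<^sub>0 + 1 / (of_int n\<^sub>1 + 1 / of_int n\<^sub>2)) =
    (fib_int (n\<^sub>1 - 1) * lucas_int n\<^sub>0 + fib_int (n\<^sub>1 - 2) * fib_int (n\<^sub>0 + 1)) * fib_int n\<^sub>2 +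
    (fib_int (n\<^sub>1 - 2) * lucas_int n\<^sub>0 + fib_int (n\<^sub>1 - 3) * fib_int (n\<^sub>0 + 1)) * fib_int (n\<^sub>2 + 1)"
proof -
  \<comment> \<open>The continued fraction is built from its innermost term outwards:
    \<open>Y\<close> is the inverted last term and \<open>Z\<close> is the tail with terms
    \<open>n\<^sub>1\<close> and \<open>n\<^sub>2\<close>.\<close>
  define Y :: rat where "Y = 1 / of_int n\<^sub>2"
  define Z :: rat where "Z = of_int n\<^sub>1 + Y"
  have Y: "Y > 0" using assms by (simp add: Y_def)
  then have Z: "1 / Z > 0" using assms by (simp add: Z_def add_pos_pos)
  have valsY: "codenominator Y = fib_int (n\<^sub>2 + 1)" "conumerator Y = fib_int n\<^sub>2"
    using assms unfolding Y_def codenominator_inverse conumerator_inverse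
    by (simp_all add: codenominator_of_int conumerator_of_int)
  have valsZ:
    "codenominator Z = fib_int (n\<^sub>1 - 1) * fib_int (n\<^sub>2 + 1) + fib_int n\<^sub>1 * fib_int n\<^sub>2"
    "conumerator Z = fib_int n\<^sub>1 * fib_int (n\<^sub>2 + 1) + fib_int (n\<^sub>1 + 1) * fib_int n\<^sub>2"
    using assms Y unfolding Z_def
    by (simp_all add: codenominator_of_int_plus conumerator_of_int_plus valsY)
  have lhs: "codenominator (of_int n\<^sub>0 + 1 / Z) =
      fib_int (n\<^sub>0 - 1) * conumerator Z + fib_int n\<^sub>0 * codenominator Z"
    using assms codenominator_of_int_plus[OF _ Z, of n\<^sub>0]
    by (simp add: codenominator_inverse conumerator_inverse)
  \<comment> \<open>These reduce every index to \<open>n\<^sub>1 - 2\<close>,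
    \<open>n\<^sub>1 - 3\<close>, \<open>n\<^sub>0\<close>, \<open>n\<^sub>0 - 1\<close>,
    \<open>n\<^sub>2\<close> or \<open>n\<^sub>2 + 1\<close>, after which the two sides agree as
    polynomials in those Fibonacci numbers.\<close>
  have rec: "fib_int (n\<^sub>1 + 1) = fib_int n\<^sub>1 + fib_int (n\<^sub>1 - 1)"
    "fib_int n\<^sub>1 = fib_int (n\<^sub>1 - 1) + fib_int (n\<^sub>1 - 2)"
    "fib_int (n\<^sub>1 - 1) = fib_int (n\<^sub>1 - 2) + fib_int (n\<^sub>1 - 3)"
    "fib_int (n\<^sub>0 + 1) = fib_int n\<^sub>0 + fib_int (n\<^sub>0 - 1)"
    using fib_int_rec[of "n\<^sub>1 - 1"] fib_int_rec[of "n\<^sub>1 - 2"] fib_int_rec[of "n\<^sub>1 - 3"]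
      fib_int_rec[of "n\<^sub>0 - 1"]
    by (simp_all add: add.commute)
  have "codenominator (of_int n\<^sub>0 + 1 / Z) =
    (fib_int (n\<^sub>1 - 1) * lucas_int n\<^sub>0 + fib_int (n\<^sub>1 - 2) * fib_int (n\<^sub>0 + 1)) * fib_int n\<^sub>2 +
    (fib_int (n\<^sub>1 - 2) * lucas_int n\<^sub>0 + fib_int (n\<^sub>1 - 3) * fib_int (n\<^sub>0 + 1)) * fib_int (n\<^sub>2 + 1)"
    unfolding lhs valsZ lucas_int_eq_fib_int[OF assms(1)] rec
    by (simp add: algebra_simps)
  then show ?thesis by (simp add: Z_def Y_def)
qed

end
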